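(* There are positive constants $c$ and $c'$ such that for all integers $n\ge 2$, \[ 2^{c\log^2 n}\;\le\; \mathrm{gr}(\Gamma_{2\times 2},K_n)\;\le\; 2^{c' n^{2/3}\log n}. \]
   Context: The $m\times n$ grid graph $\Gamma_{m\times n}$ is the Cartesian product $K_m\square K_n$: its vertex set is $[m]\times[n]$ and two distinct vertices are adjacent iff they share exactly one coordinate. An $a\times b$ subgrid of $\Gamma_{m\times n}$ is an induced copy of $\Gamma_{a\times b}$, i.e. the induced subgraph on $X\times Y$ with $X\subseteq[m]$, $|X|=a$, $Y\subseteq[n]$, $|Y|=b$ (or with the roles of the coordinates swapped). A rectangle is a $2\times 2$ subgrid, i.e. four vertices $(x,y),(x,y'),(x',y'),(x',y)$ with $x\neq x'$, $y\ne y'$, together with the four edges between them sharing a coordinate. $\mathrm{gr}(\Gamma_{2\times2},K_n)$ is the smallest $N$ such that every red/blue coloring of the edges of $\Gamma_{N\times N}$ contains a rectangle all of whose four edges are red, or a clique on $n$ vertices (in $\Gamma_{N\times N}$) all of whose edges are blue. Logarithms are base $2$. *)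

theory Defs
  imports Complex_Main "HOL-Library.Extended_Real"
begin

definition grid_verts :: "nat \<Rightarrow> nat \<Rightarrow> (nat \<times> nat) set" where
  "grid_verts m n = {1..m} \<times> {1..n}"

text \<open>Two vertices are adjacent iff they share exactly one coordinate; the inequality of
  truth values below is exclusive or, and it already forces the vertices to be distinct.\<close>

definition grid_adj :: "nat \<times> nat \<Rightarrow> nat \<times> nat \<Rightarrow> bool" where
  "grid_adj u v \<longleftrightarrow> (fst u = fst v) \<noteq> (snd u = snd v)"

definition grid_edges :: "nat \<Rightarrow> nat \<Rightarrow> (nat \<times> nat) set set" where
  "grid_edges m n = {{u, v} | u v. u \<in> grid_verts m n \<and> v \<in> grid_verts m n \<and> grid_adj u v}"

text \<open>Induced subgraphs of the grid graph (subgrids, cliques) are represented by their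
  vertex sets.\<close>

definition is_subgrid :: "nat \<Rightarrow> nat \<Rightarrow> nat \<Rightarrow> nat \<Rightarrow> (nat \<times> nat) set \<Rightarrow> bool" where
  "is_subgrid m n a b S \<longleftrightarrow>
     (\<exists>X Y. X \<subseteq> {1..m} \<and> Y \<subseteq> {1..n} \<and> S = X \<times> Y \<and>
        (card X = a \<and> card Y = b \<or> card X = b \<and> card Y = a))"

abbreviation is_rectangle :: "nat \<Rightarrow> nat \<Rightarrow> (nat \<times> nat) set \<Rightarrow> bool" where
  "is_rectangle m n S \<equiv> is_subgrid m n 2 2 S"

definition is_clique :: "nat \<Rightarrow> nat \<Rightarrow> nat \<Rightarrow> (nat \<times> nat) set \<Rightarrow> bool" where
  "is_clique m n k S \<longleftrightarrow>
     S \<subseteq> grid_verts m n \<and> card S = k \<and> (\<forall>u\<in>S. \<forall>v\<in>S. u \<noteq> v \<longrightarrow> grid_adj u v)"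

datatype colour = Red | Blue

text \<open>A colouring is a total function on sets of vertices; only its values on
  \<^term>\<open>grid_edges m n\<close> matter.\<close>

definition monochromatic ::
  "nat \<Rightarrow> nat \<Rightarrow> ((nat \<times> nat) set \<Rightarrow> colour) \<Rightarrow> colour \<Rightarrow> (nat \<times> nat) set \<Rightarrow> bool" where
  "monochromatic m n \<chi> c S \<longleftrightarrow> (\<forall>e\<in>grid_edges m n. e \<subseteq> S \<longrightarrow> \<chi> e = c)"

definition grid_arrows :: "nat \<Rightarrow> nat \<Rightarrow> bool" where
  "grid_arrows N n \<longleftrightarrow>
     (\<forall>\<chi>. (\<exists>S. is_rectangle N N S \<and> monochromatic N N \<chi> Red S) \<or>
          (\<exists>S. is_clique N N n S \<and> monochromatic N N \<chi> Blue S))"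

text \<open>The smallest \<open>N\<close> such that \<^term>\<open>grid_arrows N n\<close>. The infimum is taken in
  \<^typ>\<open>enat\<close>, so the value would be \<open>\<infinity>\<close> if there were no such \<open>N\<close>; a finite upper bound thus
  includes the existence of \<open>N\<close>.\<close>

definition gr_rect :: "nat \<Rightarrow> enat" where
  "gr_rect n = Inf {enat N | N. grid_arrows N n}"

end

theory Submission
  imports Defs "HOL-Library.FuncSet"
begin

text \<open>
  Upper bound. Put \<open>r = \<lceil>n\<^bsup>1/3\<^esup>\<rceil>\<close>. Without a blue \<open>K\<^sub>n\<close>, every column contains a red \<open>r\<close>-clique
  within the first \<open>n\<^bsup>r\<^esup>\<close> rows, so some \<open>r\<close> rows form a red clique in an \<open>n\<^bsup>-r\<^sup>2\<^esup>\<close> fraction \<open>Y\<close> of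
  all columns. Without a red rectangle, the red graphs of these \<open>r\<close> rows are pairwise edge-disjoint
  on \<open>Y\<close>, so one of them has density at most \<open>1/r\<close>. As in the Erdos-Szemeredi theorem, it
  then has an independent set or a clique of size \<open>n\<close> as soon as \<open>\<bar>Y\<bar>\<close> is \<open>n\<^bsup>O(n/r)\<^esup>\<close>, and a clique of
  one red graph is independent in all the others.

  Lower bound. Take \<open>L = s\<^sup>2\<close> with \<open>s\<close> of order \<open>log n\<close>, label the columns by distinct binary strings
  of length \<open>L\<close> and the rows by words of length \<open>L\<close> over \<open>2\<^sup>s\<close> letters, any two of which agree in at
  most \<open>2s\<close> positions. Give every pair of columns a random letter and every pair of rows a random binary
  string. In row \<open>x\<close> a pair of columns is red iff its letter is the letter of \<open>x\<close> at a fixed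
  position where the two columns differ; in column \<open>y\<close> a pair of rows is red iff its string equals
  \<open>y\<close> on the positions where the two rows agree. In a red rectangle the two rows would
  agree at a position where the two columns differ, but both columns equal the string of the pair of rows
  there. Every edge is red with probability at least \<open>2\<^bsup>-2s\<^esup>\<close>, which rules out blue cliques.
\<close>

subsection \<open>Ramsey and pigeonhole bounds\<close>

text \<open>Splitting off a vertex leaves its neighbours and its non-neighbours. For positive
  \<open>r\<close> and \<open>n\<close>, the inequality
  \<open>n ^ (r - 1) + (n - 1) ^ r \<le> n ^ r\<close> makes one of the two classes large enough for
  induction on \<open>r + n\<close>.\<close>

lemma ramsey_power_bound:
  fixes E :: "'a \<Rightarrow> 'a \<Rightarrow> bool"
  assumes "\<And>u v. E u v \<Longrightarrow> E v u" and "finite V" and "n ^ r \<le> card V"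
  shows "(\<exists>S\<subseteq>V. card S = r \<and> (\<forall>u\<in>S. \<forall>v\<in>S. u \<noteq> v \<longrightarrow> E u v)) \<or>
         (\<exists>S\<subseteq>V. card S = n \<and> (\<forall>u\<in>S. \<forall>v\<in>S. u \<noteq> v \<longrightarrow> \<not> E u v))"
  using assms(2,3)
proof (induction "r + n" arbitrary: r n V rule: less_induct)
  case less
  show ?case
  proof (cases "r = 0 \<or> n = 0")
    case True
    then show ?thesis by (metis card.empty empty_iff empty_subsetI)
  next
    case False
    then obtain r' n' where rn: "r = Suc r'" "n = Suc n'" by (metis not0_implies_Suc)
    have "card V > 0" using less.prems rn by (metis less_le_trans zero_less_Suc zero_less_power)
    then obtain v where v: "v \<in> V" by (metis card_gt_0_iff ex_in_conv)
    define P where "P = {u \<in> V - {v}. E v u}"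
    define Q where "Q = {u \<in> V - {v}. \<not> E v u}"
    have PQ: "P \<subseteq> V - {v}" "Q \<subseteq> V - {v}" "finite P" "finite Q"
      using less.prems by (auto simp: P_def Q_def)
    have "V = insert v (P \<union> Q)" using v by (auto simp: P_def Q_def)
    moreover have "v \<notin> P \<union> Q" "P \<inter> Q = {}" by (auto simp: P_def Q_def)
    ultimately have cV: "card V = Suc (card P + card Q)"
      using PQ by (metis card_Un_disjoint card_insert_disjoint finite_UnI)
    have "n' ^ r \<le> n' * n ^ r'" using rn by (simp add: power_mono)
    then have "n ^ r' + n' ^ r \<le> n ^ r" using rn by simp
    then consider "n ^ r' \<le> card P" | "n' ^ r \<le> card Q" using cV less.prems(2) by linarith
    then show ?thesis
    proof cases
      case 1
      have "(\<exists>S\<subseteq>P. card S = r' \<and> (\<forall>u\<in>S. \<forall>v\<in>S. u \<noteq> v \<longrightarrow> E u v)) \<or>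
        (\<exists>S\<subseteq>P. card S = n \<and> (\<forall>u\<in>S. \<forall>v\<in>S. u \<noteq> v \<longrightarrow> \<not> E u v))"
        using less.hyps[OF _ PQ(3) 1] rn by simp
      then show ?thesis
      proof (elim disjE)
        assume "\<exists>S\<subseteq>P. card S = r' \<and> (\<forall>u\<in>S. \<forall>v\<in>S. u \<noteq> v \<longrightarrow> E u v)"
        then obtain S where S: "S \<subseteq> P" "card S = r'" "\<forall>u\<in>S. \<forall>v\<in>S. u \<noteq> v \<longrightarrow> E u v" by blast
        have "finite S" "v \<notin> S" using S PQ finite_subset by (blast, auto simp: P_def)
        then have "card (insert v S) = r" using S rn by simp
        moreover have "insert v S \<subseteq> V" using S PQ v by blast
        moreover have "\<forall>u\<in>insert v S. \<forall>w\<in>insert v S. u \<noteq> w \<longrightarrow> E u w"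
          using S assms(1) by (auto simp: P_def)
        ultimately show ?thesis by (intro disjI1) blast
      next
        assume "\<exists>S\<subseteq>P. card S = n \<and> (\<forall>u\<in>S. \<forall>v\<in>S. u \<noteq> v \<longrightarrow> \<not> E u v)"
        then show ?thesis using PQ by (intro disjI2) (elim exE conjE, intro exI conjI, auto)
      qed
    next
      case 2
      have "(\<exists>S\<subseteq>Q. card S = r \<and> (\<forall>u\<in>S. \<forall>v\<in>S. u \<noteq> v \<longrightarrow> E u v)) \<or>
        (\<exists>S\<subseteq>Q. card S = n' \<and> (\<forall>u\<in>S. \<forall>v\<in>S. u \<noteq> v \<longrightarrow> \<not> E u v))"
        using less.hyps[OF _ PQ(4) 2] rn by simp
      then show ?thesis
      proof (elim disjE)
        assume "\<exists>S\<subseteq>Q. card S = r \<and> (\<forall>u\<in>S. \<forall>v\<in>S. u \<noteq> v \<longrightarrow> E u v)"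
        then show ?thesis using PQ by (intro disjI1) (elim exE conjE, intro exI conjI, auto)
      next
        assume "\<exists>S\<subseteq>Q. card S = n' \<and> (\<forall>u\<in>S. \<forall>v\<in>S. u \<noteq> v \<longrightarrow> \<not> E u v)"
        then obtain S where S: "S \<subseteq> Q" "card S = n'" "\<forall>u\<in>S. \<forall>v\<in>S. u \<noteq> v \<longrightarrow> \<not> E u v" by blast
        have "finite S" "v \<notin> S" using S PQ finite_subset by (blast, auto simp: Q_def)
        then have "card (insert v S) = n" using S rn by simp
        moreover have "insert v S \<subseteq> V" using S PQ v by blast
        moreover have "\<forall>u\<in>insert v S. \<forall>w\<in>insert v S. u \<noteq> w \<longrightarrow> \<not> E u w"
          using S assms(1) by (auto simp: Q_def)
        ultimately show ?thesis by (intro disjI2) blast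
      qed
    qed
  qed
qed

text \<open>Padding an enumeration of the subset with \<open>None\<close> gives a word of length
  \<open>b\<close> over an alphabet of \<open>card A + 1\<close> letters, and the subset can be
  recovered from this word.\<close>

lemma card_bounded_subsets_le:
  assumes "finite A"
  shows "card {B. B \<subseteq> A \<and> card B \<le> b} \<le> (card A + 1) ^ b"
proof -
  let ?O = "insert None (Some ` A)"
  let ?F = "{xs. set xs \<subseteq> ?O \<and> length xs = b}"
  have "{B. B \<subseteq> A \<and> card B \<le> b} \<subseteq> (\<lambda>xs. {a. Some a \<in> set xs}) ` ?F"
  proof
    fix B assume "B \<in> {B. B \<subseteq> A \<and> card B \<le> b}"
    then have B: "B \<subseteq> A" "card B \<le> b" by auto
    obtain ys where ys: "set ys = B" "distinct ys"
      using B assms by (metis finite_distinct_list finite_subset)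
    then have "length ys = card B" by (metis distinct_card)
    then have "map Some ys @ replicate (b - card B) None \<in> ?F"
      using B ys by auto
    moreover have "B = {a. Some a \<in> set (map Some ys @ replicate (b - card B) None)}"
      using ys by auto
    ultimately show "B \<in> (\<lambda>xs. {a. Some a \<in> set xs}) ` ?F" by blast
  qed
  then have "card {B. B \<subseteq> A \<and> card B \<le> b} \<le> card ?F"
    using assms by (intro surj_card_le finite_lists_length_eq) auto
  also have "\<dots> = (card A + 1) ^ b"
    using assms by (subst card_lists_length_eq) (auto simp: card_image)
  finally show ?thesis .
qed

lemma pigeonhole_fibre:
  assumes "finite X" "f ` X \<subseteq> K" "finite K" "m * card K < card X"
  shows "\<exists>k\<in>K. m < card {x \<in> X. f x = k}"
proof (rule ccontr)
  assume "\<not> ?thesis"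
  then have "\<And>k. k \<in> K \<Longrightarrow> card {x \<in> X. f x = k} \<le> m" by force
  moreover have "(\<Sum>k\<in>K. card {x \<in> X. f x = k}) = card X"
    using sum.group[OF assms(1,3,2), of "\<lambda>_. 1::nat"] by simp
  ultimately have "card X \<le> card K * m"
    using sum_bounded_above[of K "\<lambda>k. card {x \<in> X. f x = k}" m] by simp
  with assms(4) show False by (simp add: mult.commute)
qed

subsection \<open>Edge-disjoint graphs without large independent sets\<close>

text \<open>One of the graphs is sparse by averaging, and the Erdos-Szemeredi argument applies to
  it. A maximum independent set \<open>A\<close> of low-degree vertices has fewer than
  \<open>n\<close> elements, at most half of the low-degree vertices lie outside \<open>A\<close>
  and have more than \<open>8 * n div card I\<close> neighbours in it, and the rest fall into few
  classes according to their neighbours in \<open>A\<close>.\<close>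

lemma disjoint_graphs_bound:
  fixes R :: "'i \<Rightarrow> 'a \<Rightarrow> 'a \<Rightarrow> bool"
  assumes finY: "finite Y" and sym: "\<And>i u v. R i u v \<Longrightarrow> R i v u" and irr: "\<And>i u. \<not> R i u u"
    and disj: "\<And>i j u v. i \<in> I \<Longrightarrow> j \<in> I \<Longrightarrow> u \<in> Y \<Longrightarrow> v \<in> Y \<Longrightarrow> R i u v \<Longrightarrow> R j u v \<Longrightarrow> i = j"
    and r: "2 \<le> card I" and n: "2 \<le> n"
    and noindep: "\<And>i S. i \<in> I \<Longrightarrow> S \<subseteq> Y \<Longrightarrow> card S = n \<Longrightarrow> \<exists>u\<in>S. \<exists>v\<in>S. R i u v"
  shows "card Y < n ^ (2 * (8 * n div card I) + 4)"
proof -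
  define r where "r = card I"
  define N where "N = card Y"
  \<comment> \<open>Below, the numbers of neighbours in \<open>A\<close> add up to at most
    \<open>4 * n / r\<close> times \<open>card L\<close>; doubling this threshold excludes at most
    half of \<open>L\<close>.\<close>
  define b where "b = 8 * n div r"
  define deg where "deg i v = card {w \<in> Y. R i v w}" for i v
  have r2: "2 \<le> r" and finI: "finite I"
    using r card_ge_0_finite[of I] by (simp_all add: r_def)
  \<comment> \<open>By edge-disjointness, the neighbourhoods of \<open>v\<close> in the different
    graphs are disjoint subsets of \<open>Y\<close>.\<close>
  have degsum: "(\<Sum>i\<in>I. deg i v) \<le> N" if "v \<in> Y" for v
  proof -
    have "(\<Sum>i\<in>I. deg i v) = card (\<Union>i\<in>I. {w \<in> Y. R i v w})"
      unfolding deg_def using finI finY disj that by (subst card_UN_disjoint) auto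
    also have "\<dots> \<le> N"
      unfolding N_def using finY by (intro card_mono) auto
    finally show ?thesis .
  qed
  have total: "(\<Sum>i\<in>I. \<Sum>v\<in>Y. deg i v) \<le> N * N"
    using degsum sum_bounded_above[of Y "\<lambda>v. \<Sum>i\<in>I. deg i v" N]
    by (subst sum.swap) (simp add: N_def)
  obtain i where i: "i \<in> I" "r * (\<Sum>v\<in>Y. deg i v) \<le> N * N"
  proof -
    have "\<exists>i\<in>I. r * (\<Sum>v\<in>Y. deg i v) \<le> N * N"
    proof (rule ccontr)
      assume "\<not> ?thesis"
      then have "\<And>i. i \<in> I \<Longrightarrow> N * N < r * (\<Sum>v\<in>Y. deg i v)" by (simp add: not_le)
      moreover have "I \<noteq> {}" using r by auto
      ultimately have "(\<Sum>i\<in>I. N * N) < (\<Sum>i\<in>I. r * (\<Sum>v\<in>Y. deg i v))"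
        using finI by (intro sum_strict_mono)
      also have "\<dots> = r * (\<Sum>i\<in>I. \<Sum>v\<in>Y. deg i v)" by (rule sum_distrib_left[symmetric])
      also have "\<dots> \<le> r * (N * N)" using total by (rule mult_le_mono2)
      finally show False by (simp add: r_def)
    qed
    with that show ?thesis by blast
  qed
  \<comment> \<open>The cutoff is twice the bound \<open>N / r\<close> on the average degree in
    graph \<open>i\<close>, so by Markov's inequality at least half of \<open>Y\<close>
    survives.\<close>
  define L where "L = {v \<in> Y. r * deg i v \<le> 2 * N}"
  have LY: "L \<subseteq> Y" and finL: "finite L" using finY by (auto simp: L_def)
  have halfL: "N \<le> 2 * card L"
  proof (cases "N = 0")
    case False
    have "card (Y - L) * (2 * N) \<le> (\<Sum>v\<in>Y - L. r * deg i v)"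
      using sum_bounded_below[of "Y - L" "2 * N" "\<lambda>v. r * deg i v"] by (force simp: L_def)
    also have "\<dots> \<le> (\<Sum>v\<in>Y. r * deg i v)"
      using finY by (intro sum_mono2) auto
    also have "\<dots> \<le> N * N" using i by (simp add: sum_distrib_left)
    finally have "2 * card (Y - L) \<le> N" using False by simp
    moreover have "N = card L + card (Y - L)"
      using card_Diff_subset[OF finL LY] card_mono[OF finY LY] by (simp add: N_def)
    ultimately show ?thesis by linarith
  qed simp
  define indep where "indep S \<longleftrightarrow> (\<forall>u\<in>S. \<forall>v\<in>S. \<not> R i u v)" for S
  have indep_small: "card S < n" if "S \<subseteq> Y" "indep S" for S
  proof (rule ccontr)
    assume "\<not> card S < n"
    then obtain T where "T \<subseteq> S" "card T = n"
      by (meson not_less obtain_subset_with_card_n)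
    with noindep[of i T] i that show False unfolding indep_def by blast
  qed
  obtain A where A: "A \<subseteq> L" "indep A" "\<And>S. S \<subseteq> L \<Longrightarrow> indep S \<Longrightarrow> card S \<le> card A"
  proof -
    have "\<exists>A. (A \<subseteq> L \<and> indep A) \<and> (\<forall>S. S \<subseteq> L \<and> indep S \<longrightarrow> card S \<le> card A)"
      using LY indep_small
      by (intro ex_has_greatest_nat[where k = "{}" and b = n]) (auto simp: indep_def less_imp_le)
    then show ?thesis using that by blast
  qed
  have finA: "finite A" using finite_subset[OF A(1) finL] .
  have An: "card A < n" using indep_small[OF order_trans[OF A(1) LY] A(2)] .
  \<comment> \<open>Vertices outside \<open>A\<close> with the same neighbourhood \<open>B\<close> in \<open>A\<close> span a graph of independence number at
    most \<open>card B\<close>: an independent set of them could replace \<open>B\<close> in \<open>A\<close>.\<close>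
  define pat where "pat v = {a \<in> A. R i a v}" for v
  \<comment> \<open>Double counting of the edges between \<open>A\<close> and \<open>L - A\<close>:
    seen from \<open>A\<close>, each vertex contributes at most its degree, which is small because
    \<open>A\<close> lies in \<open>L\<close>.\<close>
  have "(\<Sum>v\<in>L - A. card (pat v)) \<le> (\<Sum>a\<in>A. deg i a)"
  proof -
    have "(\<Sum>v\<in>L - A. card (pat v)) = (\<Sum>a\<in>A. card {v \<in> L - A. R i a v})"
      unfolding pat_def using finL finA by (intro sum_multicount_gen) auto
    also have "\<dots> \<le> (\<Sum>a\<in>A. deg i a)"
      unfolding deg_def using finY LY by (intro sum_mono card_mono) auto
    finally show ?thesis .
  qed
  then have "r * (\<Sum>v\<in>L - A. card (pat v)) \<le> (\<Sum>a\<in>A. r * deg i a)"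
    by (simp add: sum_distrib_left[symmetric])
  also have "\<dots> \<le> card A * (2 * N)"
    using sum_bounded_above[of A "\<lambda>a. r * deg i a" "2 * N"] A(1) by (force simp: L_def)
  also have "\<dots> \<le> n * (4 * card L)"
    using mult_le_mono[of "card A" n "2 * N" "4 * card L"] An halfL by linarith
  finally have patsum: "(\<Sum>v\<in>L - A. r * card (pat v)) \<le> n * (4 * card L)"
    by (simp add: sum_distrib_left)
  define G where "G = {v \<in> L - A. r * card (pat v) \<le> 8 * n}"
  have "card (L - A - G) * (8 * n) \<le> (\<Sum>v\<in>L - A - G. r * card (pat v))"
    using sum_bounded_below[of "L - A - G" "8 * n" "\<lambda>v. r * card (pat v)"] by (force simp: G_def)
  also have "\<dots> \<le> (\<Sum>v\<in>L - A. r * card (pat v))"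
    using finL by (intro sum_mono2) auto
  also have "\<dots> \<le> n * (4 * card L)" by (rule patsum)
  finally have "(4 * n) * (2 * card (L - A - G)) \<le> (4 * n) * card L"
    by (simp add: algebra_simps)
  then have "2 * card (L - A - G) \<le> card L" using n by simp
  moreover have "card L \<le> card A + card G + card (L - A - G)"
  proof -
    have "L = A \<union> G \<union> (L - A - G)" using A by (auto simp: G_def)
    then have "card L \<le> card (A \<union> G) + card (L - A - G)" by (metis card_Un_le)
    with card_Un_le[of A G] show ?thesis by linarith
  qed
  ultimately have cG: "N < 4 * n + 4 * card G" using An halfL by linarith
  have patb: "pat ` G \<subseteq> {B. B \<subseteq> A \<and> card B \<le> b}"
    using r2 by (auto simp: pat_def[of] G_def b_def less_eq_div_iff_mult_less_eq mult.commute)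
  have fibre: "card {v \<in> G. pat v = B} < n ^ (b + 1)" if "B \<subseteq> A" "card B \<le> b" for B
  proof (rule ccontr)
    let ?W = "{v \<in> G. pat v = B}"
    assume "\<not> card ?W < n ^ (b + 1)"
    then have le: "n ^ (b + 1) \<le> card ?W" by simp
    have finW: "finite ?W" using finL by (simp add: G_def)
    have symn: "\<not> R i v u" if "\<not> R i u v" for u v using that sym by blast
    \<comment> \<open>Ramsey for the complement of graph \<open>i\<close>: the set of size
      \<open>b + 1\<close> is independent in graph \<open>i\<close>, the set of size
      \<open>n\<close> is a clique of it.\<close>
    have "(\<exists>S\<subseteq>?W. card S = b + 1 \<and> (\<forall>u\<in>S. \<forall>v\<in>S. u \<noteq> v \<longrightarrow> \<not> R i u v)) \<or>
          (\<exists>S\<subseteq>?W. card S = n \<and> (\<forall>u\<in>S. \<forall>v\<in>S. u \<noteq> v \<longrightarrow> R i u v))"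
      using ramsey_power_bound[of "\<lambda>u v. \<not> R i u v" ?W n "b + 1"] symn finW le by simp
    then show False
    proof (elim disjE exE conjE)
      fix S assume S: "S \<subseteq> ?W" "card S = b + 1" and ind: "\<forall>u\<in>S. \<forall>v\<in>S. u \<noteq> v \<longrightarrow> \<not> R i u v"
      have "S \<subseteq> L" "S \<inter> A = {}" using S by (auto simp: G_def)
      have nb: "\<not> R i a s" "\<not> R i s a" if "a \<in> A - B" "s \<in> S" for a s
        using that S(1) sym by (auto simp: pat_def)
      have "indep ((A - B) \<union> S)"
        unfolding indep_def
      proof (intro ballI)
        fix u v assume "u \<in> A - B \<union> S" "v \<in> A - B \<union> S"
        then consider "u \<in> A" "v \<in> A" | "u \<in> A - B" "v \<in> S" | "u \<in> S" "v \<in> A - B" | "u \<in> S" "v \<in> S"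
          by blast
        then show "\<not> R i u v"
        proof cases
          case 1
          then show ?thesis using A(2) by (simp add: indep_def)
        next
          case 4
          then show ?thesis using ind irr by (cases "u = v") auto
        qed (simp_all add: nb)
      qed
      moreover have "(A - B) \<union> S \<subseteq> L" using A \<open>S \<subseteq> L\<close> by blast
      ultimately have "card ((A - B) \<union> S) \<le> card A" using A(3) by blast
      moreover have "card ((A - B) \<union> S) = card A - card B + card S"
        using finA \<open>S \<inter> A = {}\<close> finite_subset[OF \<open>S \<subseteq> L\<close> finL] that(1) finite_subset[OF that(1) finA]
        by (subst card_Un_disjoint) (auto simp: card_Diff_subset)
      ultimately show False
        using S(2) that card_mono[OF finA that(1)] by linarith
    next
      fix S assume 2: "S \<subseteq> ?W" "card S = n" "\<forall>u\<in>S. \<forall>v\<in>S. u \<noteq> v \<longrightarrow> R i u v"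
      \<comment> \<open>Any second graph has an edge inside the \<open>n\<close>-clique of graph
        \<open>i\<close>, against edge-disjointness.\<close>
      obtain j where j: "j \<in> I" "j \<noteq> i"
        using r by (metis card_le_Suc0_iff_eq finI i(1) not_less_eq_eq numeral_2_eq_2)
      have "S \<subseteq> Y" using 2(1) LY by (auto simp: G_def)
      from noindep[OF j(1) this 2(2)] obtain u v where "u \<in> S" "v \<in> S" "R j u v" by blast
      with 2(3) irr have "R i u v" by metis
      with \<open>R j u v\<close> disj i j show False
        using \<open>S \<subseteq> Y\<close> \<open>u \<in> S\<close> \<open>v \<in> S\<close> by blast
    qed
  qed
  \<comment> \<open>Since \<open>card A + 1 \<le> n\<close>, there are at most \<open>n ^ b\<close>
    possible neighbourhoods in \<open>A\<close>.\<close>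
  have "card G \<le> n ^ (b + 1) * n ^ b"
  proof (rule ccontr)
    assume "\<not> ?thesis"
    moreover have "card {B. B \<subseteq> A \<and> card B \<le> b} \<le> n ^ b"
      using card_bounded_subsets_le[OF finA, of b] power_mono[of "card A + 1" n b] An by simp
    ultimately have less: "n ^ (b + 1) * card {B. B \<subseteq> A \<and> card B \<le> b} < card G"
      using mult_le_mono2[of "card {B. B \<subseteq> A \<and> card B \<le> b}" "n ^ b" "n ^ (b + 1)"] by linarith
    have "finite G" "finite {B. B \<subseteq> A \<and> card B \<le> b}"
      using finL finA by (simp_all add: G_def)
    from pigeonhole_fibre[OF this(1) patb this(2) less] obtain B
      where "B \<subseteq> A" "card B \<le> b" "n ^ (b + 1) < card {v \<in> G. pat v = B}" by blast
    with fibre[of B] show False by simp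
  qed
  also have "\<dots> = n ^ (2 * b + 1)" by (simp add: power_add[symmetric] mult_2)
  finally have "N < 4 * n + 4 * n ^ (2 * b + 1)" using cG by linarith
  also have "\<dots> \<le> 8 * n ^ (2 * b + 1)"
    using self_le_power[of n "2 * b + 1"] n by simp
  \<comment> \<open>The constant 8 is absorbed by \<open>n ^ 3\<close>, as \<open>n\<close> is at
    least 2; this accounts for the final \<open>+ 4\<close> in the exponent.\<close>
  also have "\<dots> \<le> n ^ 3 * n ^ (2 * b + 1)"
    using power_mono[of 2 n 3] n by simp
  also have "\<dots> = n ^ (3 + (2 * b + 1))" by (rule power_add[symmetric])
  also have "3 + (2 * b + 1) = 2 * b + 4" by simp
  finally show ?thesis by (simp add: N_def b_def r_def)
qed

subsection \<open>Red cliques shared by many columns\<close>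

lemma monochromatic_column:
  assumes "\<forall>x\<in>T. \<forall>x'\<in>T. x \<noteq> x' \<longrightarrow> \<chi> {(x, y), (x', y)} = c"
  shows "monochromatic m n \<chi> c (T \<times> {y})"
  using assms unfolding monochromatic_def grid_edges_def grid_adj_def by auto

lemma monochromatic_row:
  assumes "\<forall>y\<in>T. \<forall>y'\<in>T. y \<noteq> y' \<longrightarrow> \<chi> {(x, y), (x, y')} = c"
  shows "monochromatic m n \<chi> c ({x} \<times> T)"
  using assms unfolding monochromatic_def grid_edges_def grid_adj_def by auto

lemma is_clique_column:
  assumes "T \<subseteq> {1..m}" "y \<in> {1..n}" "card T = k"
  shows "is_clique m n k (T \<times> {y})"
  using assms unfolding is_clique_def grid_verts_def grid_adj_def
  by (auto simp: card_cartesian_product)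

lemma is_clique_row:
  assumes "x \<in> {1..m}" "T \<subseteq> {1..n}" "card T = k"
  shows "is_clique m n k ({x} \<times> T)"
  using assms unfolding is_clique_def grid_verts_def grid_adj_def
  by (auto simp: card_cartesian_product)

lemma monochromatic_rectangle:
  assumes "{x, x'} \<subseteq> {1..m}" "{y, y'} \<subseteq> {1..n}" "x \<noteq> x'" "y \<noteq> y'"
    and "\<chi> {(x, y), (x', y)} = c" "\<chi> {(x, y'), (x', y')} = c"
    and "\<chi> {(x, y), (x, y')} = c" "\<chi> {(x', y), (x', y')} = c"
  shows "\<exists>S. is_rectangle m n S \<and> monochromatic m n \<chi> c S"
proof (intro exI conjI)
  show "is_rectangle m n ({x, x'} \<times> {y, y'})"
    unfolding is_subgrid_def using assms by (intro exI[of _ "{x, x'}"] exI[of _ "{y, y'}"]) auto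
  show "monochromatic m n \<chi> c ({x, x'} \<times> {y, y'})"
    unfolding monochromatic_def
  proof (intro ballI impI)
    fix e assume "e \<in> grid_edges m n" and sub: "e \<subseteq> {x, x'} \<times> {y, y'}"
    then obtain u v where e: "e = {u, v}" and adj: "grid_adj u v"
      unfolding grid_edges_def by blast
    have "u \<in> {(x, y), (x, y'), (x', y), (x', y')}" "v \<in> {(x, y), (x, y'), (x', y), (x', y')}"
      using sub e by auto
    moreover have "\<chi> {(x', y), (x, y)} = c" "\<chi> {(x', y'), (x, y')} = c"
      "\<chi> {(x, y'), (x, y)} = c" "\<chi> {(x', y'), (x', y)} = c"
      using assms by (simp_all add: doubleton_eq_iff insert_commute)
    ultimately show "\<chi> e = c"
      using adj assms(3-) unfolding e grid_adj_def by (elim insertE emptyE) simp_all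
  qed
qed

lemma not_Red: "c \<noteq> Red \<longleftrightarrow> c = Blue"
  by (cases c) auto

text \<open>The summand \<open>r\<^sup>2\<close> in the exponent pays for passing to columns that
  share a red \<open>r\<close>-clique; the rest is the bound of \<open>disjoint_graphs_bound\<close>
  for the red graphs of these \<open>r\<close> rows.\<close>

lemma grid_arrows_power:
  assumes r: "2 \<le> r" and n: "2 \<le> n" and N: "N = n ^ (r\<^sup>2 + (2 * (8 * n div r) + 4))"
  shows "grid_arrows N n"
  unfolding grid_arrows_def
proof (intro allI, rule ccontr)
  fix \<chi> :: "(nat \<times> nat) set \<Rightarrow> colour"
  assume contra: "\<not> ((\<exists>S. is_rectangle N N S \<and> monochromatic N N \<chi> Red S) \<or>
    (\<exists>S. is_clique N N n S \<and> monochromatic N N \<chi> Blue S))"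
  define C where "C y x x' \<longleftrightarrow> x \<noteq> x' \<and> \<chi> {(x, y), (x', y)} = Red" for y x x'
  define R where "R x y y' \<longleftrightarrow> y \<noteq> y' \<and> \<chi> {(x, y), (x, y')} = Red" for x y y'
  have Csym: "C y x' x" if "C y x x'" for y x x'
    using that by (auto simp: C_def insert_commute)
  have Rsym: "R x y' y" if "R x y y'" for x y y'
    using that by (auto simp: R_def insert_commute)
  have Cred: "\<exists>x\<in>T. \<exists>x'\<in>T. C y x x'" if "T \<subseteq> {1..N}" "y \<in> {1..N}" "card T = n" for y T
  proof (rule ccontr)
    assume "\<not> ?thesis"
    then have "\<forall>x\<in>T. \<forall>x'\<in>T. x \<noteq> x' \<longrightarrow> \<chi> {(x, y), (x', y)} \<noteq> Red"
      by (auto simp: C_def)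
    then have "\<forall>x\<in>T. \<forall>x'\<in>T. x \<noteq> x' \<longrightarrow> \<chi> {(x, y), (x', y)} = Blue"
      unfolding not_Red .
    from monochromatic_column[where \<chi> = \<chi>, OF this] is_clique_column[OF that] contra show False by blast
  qed
  have Rred: "\<exists>y\<in>T. \<exists>y'\<in>T. R x y y'" if "x \<in> {1..N}" "T \<subseteq> {1..N}" "card T = n" for x T
  proof (rule ccontr)
    assume "\<not> ?thesis"
    then have "\<forall>y\<in>T. \<forall>y'\<in>T. y \<noteq> y' \<longrightarrow> \<chi> {(x, y), (x, y')} \<noteq> Red"
      by (auto simp: R_def)
    then have "\<forall>y\<in>T. \<forall>y'\<in>T. y \<noteq> y' \<longrightarrow> \<chi> {(x, y), (x, y')} = Blue"
      unfolding not_Red .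
    from monochromatic_row[where \<chi> = \<chi>, OF this] is_clique_row[OF that] contra show False by blast
  qed
  \<comment> \<open>The column edges are assumed red only for distinct rows, so that the fact has
    the shape of the edge-disjointness hypothesis, where the two rows may coincide.\<close>
  have norect: "x = x'"
    if "x \<in> {1..N}" "x' \<in> {1..N}" "y \<in> {1..N}" "y' \<in> {1..N}"
      and "x \<noteq> x' \<Longrightarrow> C y x x'" "x \<noteq> x' \<Longrightarrow> C y' x x'" "R x y y'" "R x' y y'" for x x' y y'
  proof (rule ccontr)
    assume "x \<noteq> x'"
    with that have "\<exists>S. is_rectangle N N S \<and> monochromatic N N \<chi> Red S"
      by (intro monochromatic_rectangle[of x x' N y y']) (simp_all add: C_def R_def)
    with contra show False by blast
  qed
  define M where "M = n ^ r"
  have MN: "M \<le> N"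
    unfolding M_def N using n by (intro power_increasing) (simp_all add: power2_eq_square trans_le_add1)
  \<comment> \<open>Candidates are confined to the first \<open>M\<close> rows, which suffice for
    Ramsey, so that their number is at most \<open>M ^ r = n ^ r\<^sup>2\<close>, independently of
    \<open>N\<close>.\<close>
  define K where "K = {S. S \<subseteq> {1..M} \<and> card S = r}"
  have "\<exists>S\<in>K. \<forall>u\<in>S. \<forall>v\<in>S. u \<noteq> v \<longrightarrow> C y u v" if y: "y \<in> {1..N}" for y
  proof -
    have "(\<exists>S\<subseteq>{1..M}. card S = r \<and> (\<forall>u\<in>S. \<forall>v\<in>S. u \<noteq> v \<longrightarrow> C y u v)) \<or>
          (\<exists>S\<subseteq>{1..M}. card S = n \<and> (\<forall>u\<in>S. \<forall>v\<in>S. u \<noteq> v \<longrightarrow> \<not> C y u v))"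
      using Csym by (intro ramsey_power_bound) (auto simp: M_def)
    then show ?thesis
    proof (elim disjE exE conjE)
      fix S assume "S \<subseteq> {1..M}" "card S = n" and nC: "\<forall>u\<in>S. \<forall>v\<in>S. u \<noteq> v \<longrightarrow> \<not> C y u v"
      then have "S \<subseteq> {1..N}" using MN by auto
      from Cred[OF this y \<open>card S = n\<close>] nC show ?thesis by (auto simp: C_def)
    qed (auto simp: K_def)
  qed
  then obtain f where f: "\<And>y. y \<in> {1..N} \<Longrightarrow> f y \<in> K"
    "\<And>y u v. y \<in> {1..N} \<Longrightarrow> u \<in> f y \<Longrightarrow> v \<in> f y \<Longrightarrow> u \<noteq> v \<Longrightarrow> C y u v"
    by metis
  define B where "B = n ^ (2 * (8 * n div r) + 4)"
  have "card K \<le> n ^ r\<^sup>2"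
  proof -
    have "card K = M choose r" using n_subsets[of "{1..M}" r] by (simp add: K_def)
    also have "\<dots> \<le> M ^ r"
      by (cases "r \<le> M") (auto simp: binomial_le_pow binomial_eq_0)
    also have "\<dots> = n ^ r\<^sup>2" by (simp add: M_def power_mult[symmetric] power2_eq_square)
    finally show ?thesis .
  qed
  \<comment> \<open>The pigeonhole lemma gives a strict inequality, so \<open>B - 1\<close> is used
    to obtain a fibre of at least \<open>B\<close> columns.\<close>
  then have "(B - 1) * card K \<le> (B - 1) * n ^ r\<^sup>2" by simp
  also have "\<dots> < B * n ^ r\<^sup>2" using n by (simp add: B_def)
  also have "\<dots> = card {1..N}" by (simp add: N B_def power_add mult.commute)
  finally have less: "(B - 1) * card K < card {1..N}" .
  have "finite K" by (simp add: K_def)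
  from pigeonhole_fibre[OF _ _ this less, of f] f(1) obtain S
    where S: "S \<in> K" and big: "B - 1 < card {y \<in> {1..N}. f y = S}" by blast
  define Y where "Y = {y \<in> {1..N}. f y = S}"
  have SN: "S \<subseteq> {1..N}" and cS: "card S = r" using S MN by (auto simp: K_def)
  have "card Y < B"
    unfolding B_def cS[symmetric]
  proof (rule disjoint_graphs_bound[where R = R])
    show "i = j" if "i \<in> S" "j \<in> S" "u \<in> Y" "v \<in> Y" "R i u v" "R j u v" for i j u v
      using norect[of i j u v] f(2)[of u i j] f(2)[of v i j] that subsetD[OF SN that(1)] subsetD[OF SN that(2)]
      by (simp add: Y_def)
    show "\<exists>u\<in>T. \<exists>v\<in>T. R i u v" if "i \<in> S" "T \<subseteq> Y" "card T = n" for i T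
    proof (rule Rred)
      show "i \<in> {1..N}" "T \<subseteq> {1..N}" using that SN by (auto simp: Y_def)
    qed (rule that(3))
  qed (use Rsym cS n r in \<open>simp_all add: Y_def R_def\<close>)
  with big show False by (simp add: Y_def)
qed

subsection \<open>Random choices and codes\<close>

text \<open>Union bound for a uniformly random \<open>f\<close>, phrased by counting. Each
  \<open>e\<close> in \<open>D i\<close> succeeds with probability at least \<open>1 / K\<close>,
  independently, so index \<open>i\<close> fails with probability at most
  \<open>(1 - 1 / K) ^ m\<close>. This form serves both for random letters and for random binary
  strings.\<close>

lemma avoid_events:
  fixes D :: "'i \<Rightarrow> 'e set" and W :: "'i \<Rightarrow> 'e \<Rightarrow> 'v set"
  assumes finE: "finite E" and finV: "finite V" and V: "V \<noteq> {}" and finI: "finite I"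
    and D: "\<And>i. i \<in> I \<Longrightarrow> D i \<subseteq> E" "\<And>i. i \<in> I \<Longrightarrow> card (D i) = m"
    and W: "\<And>i e. i \<in> I \<Longrightarrow> e \<in> D i \<Longrightarrow> W i e \<subseteq> V"
      "\<And>i e. i \<in> I \<Longrightarrow> e \<in> D i \<Longrightarrow> card V \<le> K * card (W i e)"
    and bound: "real (card I) * (1 - 1 / real K) ^ m < 1"
  shows "\<exists>f. (\<forall>e\<in>E. f e \<in> V) \<and> (\<forall>i\<in>I. \<exists>e\<in>D i. f e \<in> W i e)"
proof -
  define q where "q = 1 - 1 / real K"
  \<comment> \<open>Independence shows up as a product structure: failure at \<open>i\<close>
    restricts each coordinate in \<open>D i\<close> separately.\<close>
  define bad where "bad i = PiE E (\<lambda>e. if e \<in> D i then V - W i e else V)" for i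
  define U where "U = PiE E (\<lambda>_. V)"
  have cV: "0 < real (card V)" using finV V by (simp add: card_gt_0_iff)
  have cU: "real (card U) = real (card V) ^ card E"
    unfolding U_def using finE by (simp add: card_PiE)
  have finU: "finite U" unfolding U_def using finE finV by (simp add: finite_PiE)
  have step: "real (card (V - W i e)) \<le> q * real (card V)" if "i \<in> I" "e \<in> D i" for i e
  proof -
    have "0 < K" using W(2)[OF that] cV by (cases K) auto
    have "real (card V) \<le> real K * real (card (W i e))"
      using W(2)[OF that] by (metis of_nat_le_iff of_nat_mult)
    then have "real (card V) / real K \<le> real (card (W i e))"
      using \<open>0 < K\<close> by (simp add: divide_le_eq mult.commute)
    moreover have "real (card (V - W i e)) = real (card V) - real (card (W i e))"
      using W(1)[OF that] finV by (simp add: card_Diff_subset finite_subset card_mono of_nat_diff)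
    ultimately show ?thesis by (simp add: q_def algebra_simps)
  qed
  have cbad: "real (card (bad i)) \<le> q ^ m * real (card U)" if i: "i \<in> I" for i
  proof -
    have finD: "finite (D i)" using D(1)[OF i] finE by (rule finite_subset)
    have "real (card (bad i)) = (\<Prod>e\<in>E. real (card (if e \<in> D i then V - W i e else V)))"
      unfolding bad_def using finE by (simp add: card_PiE)
    also have "\<dots> \<le> (\<Prod>e\<in>E. (if e \<in> D i then q else 1) * real (card V))"
      using step[OF i] by (intro prod_mono) auto
    also have "\<dots> = (\<Prod>e\<in>E. if e \<in> D i then q else 1) * real (card V) ^ card E"
      by (simp add: prod.distrib)
    also have "(\<Prod>e\<in>E. if e \<in> D i then q else 1) = (\<Prod>e\<in>D i. q)"
      using D(1)[OF i] finE by (simp add: prod.inter_restrict[symmetric] Int_absorb1)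
    also have "\<dots> = q ^ m" using D(2)[OF i] by simp
    finally show ?thesis by (simp add: cU)
  qed
  have "card (\<Union>i\<in>I. bad i) < card U"
  proof -
    have "real (card (\<Union>i\<in>I. bad i)) \<le> (\<Sum>i\<in>I. real (card (bad i)))"
      using card_UN_le[OF finI, of bad] by (metis of_nat_le_iff of_nat_sum)
    also have "\<dots> \<le> (\<Sum>i\<in>I. q ^ m * real (card U))" using cbad by (rule sum_mono)
    also have "\<dots> = (real (card I) * q ^ m) * real (card U)" by simp
    also have "\<dots> < 1 * real (card U)"
      using bound cV by (intro mult_strict_right_mono) (simp_all add: cU q_def)
    finally show ?thesis by simp
  qed
  then have "\<not> U \<subseteq> (\<Union>i\<in>I. bad i)"
    using card_mono[of "\<Union>i\<in>I. bad i" U] finI finE finV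
    by (force simp: bad_def intro!: finite_PiE)
  then obtain f where f: "f \<in> U" "\<And>i. i \<in> I \<Longrightarrow> f \<notin> bad i" by blast
  have "\<exists>e\<in>D i. f e \<in> W i e" if i: "i \<in> I" for i
  proof (rule ccontr)
    assume "\<not> ?thesis"
    then have "f \<in> bad i" using f(1) by (auto simp: bad_def U_def PiE_iff)
    with f(2)[OF i] show False by blast
  qed
  moreover have "\<forall>e\<in>E. f e \<in> V" using f(1) by (auto simp: U_def)
  ultimately show ?thesis by blast
qed

text \<open>Greedy choice as in the Gilbert-Varshamov bound: for each old word and each
  \<open>k\<close>-set of positions, the new word must avoid \<open>t ^ (L - k)\<close> words. There
  are at most \<open>N * 2 ^ L\<close> such pairs, so fewer than \<open>t ^ L\<close> words are
  excluded.\<close>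

lemma code_exists:
  fixes N L k t :: nat
  assumes "N * 2 ^ L < t ^ k" and kL: "k \<le> L"
  shows "\<exists>p :: nat \<Rightarrow> nat \<Rightarrow> nat. (\<forall>x\<in>{1..N}. \<forall>l<L. p x l < t) \<and>
     (\<forall>x\<in>{1..N}. \<forall>x'\<in>{1..N}. x \<noteq> x' \<longrightarrow> card {l. l < L \<and> p x l = p x' l} < k)"
  using assms(1)
proof (induction N)
  case 0
  show ?case by simp
next
  case (Suc N)
  have "N * 2 ^ L < t ^ k"
    using Suc.prems by (rule le_less_trans[rotated]) simp
  from Suc.IH[OF this] obtain p :: "nat \<Rightarrow> nat \<Rightarrow> nat" where
    p: "\<And>x l. x \<in> {1..N} \<Longrightarrow> l < L \<Longrightarrow> p x l < t"
      "\<And>x x'. x \<in> {1..N} \<Longrightarrow> x' \<in> {1..N} \<Longrightarrow> x \<noteq> x' \<Longrightarrow> card {l. l < L \<and> p x l = p x' l} < k"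
    by blast
  define Wd where "Wd = PiE {..<L} (\<lambda>_. {..<t})"
  define J where "J = {1..N} \<times> {A. A \<subseteq> {..<L} \<and> card A = k}"
  \<comment> \<open>The words that agree with the old word \<open>p x\<close> on all of
    \<open>A\<close>.\<close>
  define conf where "conf = (\<lambda>(x, A). PiE {..<L} (\<lambda>l. if l \<in> A then {p x l} else {..<t}))"
  have finJ: "finite J" by (simp add: J_def)
  have "card J \<le> N * 2 ^ L"
  proof -
    have "card J = N * (L choose k)" by (simp add: J_def card_cartesian_product n_subsets)
    also have "\<dots> \<le> N * 2 ^ L" by (simp add: binomial_le_pow2)
    finally show ?thesis .
  qed
  also have "\<dots> < t ^ k" by fact
  finally have cJ: "card J < t ^ k" .
  have t: "0 < t"
  proof (rule ccontr)
    assume "\<not> 0 < t"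
    then have "t ^ k \<le> 1" by (cases k) auto
    moreover have "0 < Suc N * 2 ^ L" by simp
    ultimately show False using Suc.prems by linarith
  qed
  have cconf: "card (conf i) = t ^ (L - k)" if iJ: "i \<in> J" for i
  proof -
    obtain x A where i: "i = (x, A)" and A: "A \<subseteq> {..<L}" "card A = k"
      using iJ by (auto simp: J_def)
    have "card (conf i) = (\<Prod>l<L. if l \<in> A then 1 else t)"
      unfolding conf_def i by (auto simp: card_PiE intro!: prod.cong)
    also have "\<dots> = (\<Prod>l\<in>{..<L} - A. t)"
      by (intro prod.mono_neutral_cong_right) auto
    also have "\<dots> = t ^ (L - k)"
      using A by (simp add: card_Diff_subset finite_subset[OF A(1)])
    finally show ?thesis .
  qed
  have "card (\<Union>i\<in>J. conf i) \<le> card J * t ^ (L - k)"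
    using card_UN_le[OF finJ, of conf] cconf by simp
  also have "\<dots> < t ^ k * t ^ (L - k)" using cJ t by simp
  also have "\<dots> = card Wd" using kL by (simp add: Wd_def card_PiE power_add[symmetric])
  finally have "\<not> Wd \<subseteq> (\<Union>i\<in>J. conf i)"
    using card_mono[of "\<Union>i\<in>J. conf i" Wd] finJ
    by (force simp: conf_def intro!: finite_PiE)
  then obtain w where w: "w \<in> Wd" "\<And>i. i \<in> J \<Longrightarrow> w \<notin> conf i" by blast
  have new: "card {l. l < L \<and> w l = p x l} < k" if x: "x \<in> {1..N}" for x
  proof (rule ccontr)
    assume "\<not> ?thesis"
    then obtain A where A: "A \<subseteq> {l. l < L \<and> w l = p x l}" "card A = k"
      by (meson not_less obtain_subset_with_card_n)
    then have "(x, A) \<in> J" using x by (auto simp: J_def)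
    moreover have "w \<in> conf (x, A)" using w(1) A(1) by (auto simp: conf_def Wd_def PiE_iff)
    ultimately show False using w(2) by blast
  qed
  define p' where "p' = p(Suc N := w)"
  have p'old: "p' x = p x" if "x \<in> {1..N}" for x using that by (simp add: p'_def)
  have p'new: "p' (Suc N) = w" by (simp add: p'_def)
  have mem: "x \<in> {1..N} \<or> x = Suc N" if "x \<in> {1..Suc N}" for x using that by auto
  show ?case
  proof (intro exI[of _ p'] conjI ballI allI impI)
    fix x l assume "x \<in> {1..Suc N}" "l < L"
    then show "p' x l < t"
      using mem[of x] p(1)[of x l] p'old[of x] p'new w(1) by (auto simp: Wd_def PiE_iff)
  next
    fix x x' assume x: "x \<in> {1..Suc N}" "x' \<in> {1..Suc N}" "x \<noteq> x'"
    then consider "x \<in> {1..N}" "x' \<in> {1..N}" | "x \<in> {1..N}" "x' = Suc N" | "x = Suc N" "x' \<in> {1..N}"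
      using mem by blast
    then show "card {l. l < L \<and> p' x l = p' x' l} < k"
    proof cases
      case 1
      then show ?thesis using p(2)[OF 1 x(3)] by (simp add: p'old)
    next
      case 2
      have "{l. l < L \<and> p x l = w l} = {l. l < L \<and> w l = p x l}" by auto
      with 2 show ?thesis using new[of x] by (simp add: p'old p'new)
    next
      case 3
      then show ?thesis using new[of x'] by (simp add: p'old p'new)
    qed
  qed
qed

subsection \<open>A colouring from a code\<close>

text \<open>If \<open>u\<close> and \<open>v\<close> differ in the first coordinate, they share the
  second; a further point off that line would have to share its first coordinate with both.\<close>

lemma clique_line:
  assumes S: "is_clique m n k S" and k: "0 < k"
  shows "(\<exists>x\<in>{1..m}. \<exists>T\<subseteq>{1..n}. card T = k \<and> S = {x} \<times> T) \<or>
         (\<exists>y\<in>{1..n}. \<exists>T\<subseteq>{1..m}. card T = k \<and> S = T \<times> {y})"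
proof -
  have sub: "S \<subseteq> {1..m} \<times> {1..n}" and cS: "card S = k"
    and adj: "\<And>u v. u \<in> S \<Longrightarrow> v \<in> S \<Longrightarrow> u \<noteq> v \<Longrightarrow> (fst u = fst v) \<noteq> (snd u = snd v)"
    using S by (auto simp: is_clique_def grid_verts_def grid_adj_def)
  obtain u where u: "u \<in> S" using cS k by (metis card.empty ex_in_conv less_irrefl)
  show ?thesis
  proof (cases "\<forall>v\<in>S. fst v = fst u")
    case True
    then have eq: "S = {fst u} \<times> snd ` S" by force
    have "card (snd ` S) = k" using cS arg_cong[OF eq, of card] by (simp add: card_cartesian_product)
    moreover have "fst u \<in> {1..m}" "snd ` S \<subseteq> {1..n}" using sub u by auto
    ultimately show ?thesis using eq by blast
  next
    case False
    then obtain v where v: "v \<in> S" "fst v \<noteq> fst u" by blast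
    have "snd v = snd u" using adj[OF v(1) u] v(2) by auto
    have "snd w = snd u" if "w \<in> S" for w
      using adj[OF that u] adj[OF that v(1)] v \<open>snd v = snd u\<close> by metis
    then have eq: "S = fst ` S \<times> {snd u}" by force
    have "card (fst ` S) = k" using cS arg_cong[OF eq, of card] by (simp add: card_cartesian_product)
    moreover have "snd u \<in> {1..n}" "fst ` S \<subseteq> {1..m}" using sub u by auto
    ultimately show ?thesis using eq by blast
  qed
qed

text \<open>Here \<open>1 / K\<close> bounds from below the probability that a given edge is red,
  which is \<open>1 / t\<close> in rows and at least \<open>1 / 2 ^ k\<close> in columns. The factor
  \<open>N ^ (n + 1)\<close> bounds the number of choices of a line and \<open>n\<close> points on
  it.\<close>

lemma not_grid_arrows_of_code:
  fixes p :: "nat \<Rightarrow> nat \<Rightarrow> nat"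
  assumes NL: "N \<le> 2 ^ L" and n: "0 < n" and t: "0 < t"
    and p: "\<And>x l. x \<in> {1..N} \<Longrightarrow> l < L \<Longrightarrow> p x l < t"
    and agree: "\<And>x x'. x \<in> {1..N} \<Longrightarrow> x' \<in> {1..N} \<Longrightarrow> x \<noteq> x' \<Longrightarrow>
      card {l. l < L \<and> p x l = p x' l} \<le> k"
    and K: "t \<le> K" "2 ^ k \<le> K"
    and bound: "real N ^ (n + 1) * (1 - 1 / real K) ^ (n choose 2) < 1"
  shows "\<not> grid_arrows N n"
proof -
  obtain \<beta> :: "nat \<Rightarrow> nat set" where \<beta>: "inj_on \<beta> {1..N}" "\<beta> ` {1..N} \<subseteq> Pow {..<L}"
    using card_le_inj[of "{1..N}" "Pow {..<L}"] NL by (auto simp: card_Pow)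
  define E where "E = {e. e \<subseteq> {1..N} \<and> card e = 2}"
  \<comment> \<open>An index is a line with \<open>n\<close> points on it; since the grid is square,
    the same family serves for rows and for columns.\<close>
  define I where "I = {1..N} \<times> {S. S \<subseteq> {1..N} \<and> card S = n}"
  define D :: "nat \<times> nat set \<Rightarrow> nat set set" where "D i = {e. e \<subseteq> snd i \<and> card e = 2}" for i
  \<comment> \<open>Quantifying over the whole set \<open>e\<close> makes \<open>agr\<close> and
    \<open>sep\<close> functions of the unordered pair: \<open>agr\<close> is applied to pairs of
    rows, \<open>sep\<close> to pairs of columns.\<close>
  define agr where "agr e = {l. l < L \<and> (\<forall>u\<in>e. \<forall>v\<in>e. p u l = p v l)}" for e
  define sep where "sep e = (SOME l. l < L \<and> (\<exists>u\<in>e. \<exists>v\<in>e. (l \<in> \<beta> u) \<noteq> (l \<in> \<beta> v)))" for e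
  have pair: "\<exists>u v. u \<in> {1..N} \<and> v \<in> {1..N} \<and> u \<noteq> v \<and> e = {u, v}" if "e \<in> E" for e
  proof -
    have "e \<subseteq> {1..N}" "card e = 2" using that by (simp_all add: E_def)
    then obtain u v where "e = {u, v}" "u \<noteq> v" unfolding card_2_iff by blast
    with \<open>e \<subseteq> {1..N}\<close> show ?thesis by blast
  qed
  have sep: "sep e < L \<and> (\<exists>u\<in>e. \<exists>v\<in>e. (sep e \<in> \<beta> u) \<noteq> (sep e \<in> \<beta> v))" if e: "e \<in> E" for e
  proof -
    obtain u v where uv: "u \<in> {1..N}" "v \<in> {1..N}" "u \<noteq> v" "e = {u, v}" using pair[OF e] by blast
    then have "\<beta> u \<noteq> \<beta> v" using \<beta>(1) by (auto dest: inj_onD)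
    then obtain l where "(l \<in> \<beta> u) \<noteq> (l \<in> \<beta> v)" by blast
    moreover from this have "l < L" using \<beta>(2) uv by blast
    ultimately show ?thesis unfolding sep_def uv(4) by (intro someI_ex[of "\<lambda>l. l < L \<and> _ l"]) blast
  qed
  have finE: "finite E" and finI: "finite I" by (simp_all add: E_def I_def)
  have DE: "D i \<subseteq> E" if "i \<in> I" for i using that by (fastforce simp: D_def E_def I_def)
  have cD: "card (D i) = n choose 2" if "i \<in> I" for i
  proof -
    have "finite (snd i)" "card (snd i) = n"
      using that finite_subset[of "snd i" "{1..N}"] by (auto simp: I_def)
    then show ?thesis using n_subsets[of "snd i" 2] by (simp add: D_def)
  qed
  have ev: "real (card I) * (1 - 1 / real K) ^ (n choose 2) < 1"
  proof -
    have "card I = N * (N choose n)" by (simp add: I_def card_cartesian_product n_subsets)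
    also have "\<dots> \<le> N * N ^ n"
      by (cases "n \<le> N") (auto simp: binomial_le_pow binomial_eq_0)
    finally have "card I \<le> N ^ (n + 1)" by simp
    then have "real (card I) \<le> real (N ^ (n + 1))" by (rule of_nat_mono)
    then have "real (card I) \<le> real N ^ (n + 1)" by (simp only: of_nat_power)
    moreover have "0 \<le> 1 - 1 / real K" using t K(1) by simp
    ultimately have "real (card I) * (1 - 1 / real K) ^ (n choose 2)
        \<le> real N ^ (n + 1) * (1 - 1 / real K) ^ (n choose 2)"
      by (intro mult_right_mono zero_le_power)
    with bound show ?thesis by linarith
  qed
  have "\<exists>\<phi>. (\<forall>e\<in>E. \<phi> e \<in> {..<t}) \<and> (\<forall>i\<in>I. \<exists>e\<in>D i. \<phi> e \<in> {p (fst i) (sep e)})"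
  proof (rule avoid_events[OF finE _ _ finI DE cD _ _ ev])
    show "{p (fst i) (sep e)} \<subseteq> {..<t}" if "i \<in> I" "e \<in> D i" for i e
      using that p[of "fst i" "sep e"] sep[of e] DE[of i] by (auto simp: I_def)
  qed (use t K in \<open>auto simp: lessThan_empty_iff\<close>)
  then obtain \<phi> where "\<forall>i\<in>I. \<exists>e\<in>D i. \<phi> e \<in> {p (fst i) (sep e)}"
    by (elim exE conjE)
  then have \<phi>: "\<exists>e\<in>D i. \<phi> e = p (fst i) (sep e)" if "i \<in> I" for i
    using that by simp
  have "\<exists>c. (\<forall>e\<in>E. c e \<in> Pow {..<L}) \<and>
    (\<forall>i\<in>I. \<exists>e\<in>D i. c e \<in> {d \<in> Pow {..<L}. d \<inter> agr e = \<beta> (fst i) \<inter> agr e})"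
  proof (rule avoid_events[OF finE _ _ finI DE cD _ _ ev])
    show "card (Pow {..<L}) \<le> K * card {d \<in> Pow {..<L}. d \<inter> agr e = \<beta> (fst i) \<inter> agr e}"
      if i: "i \<in> I" and e: "e \<in> D i" for i e
    proof -
      let ?W = "{d \<in> Pow {..<L}. d \<inter> agr e = \<beta> (fst i) \<inter> agr e}"
      let ?h = "\<lambda>d. d \<union> (\<beta> (fst i) \<inter> agr e)"
      obtain u v where uv: "u \<in> {1..N}" "v \<in> {1..N}" "u \<noteq> v" "e = {u, v}"
        using pair DE[OF i] e by blast
      have "agr e = {l. l < L \<and> p u l = p v l}" unfolding agr_def uv(4) by auto
      then have ca: "card (agr e) \<le> k" using agree[OF uv(1-3)] by simp
      have aL: "agr e \<subseteq> {..<L}" by (auto simp: agr_def)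
      \<comment> \<open>A suitable string is prescribed on \<open>agr e\<close> and free elsewhere,
        which leaves at least a fraction \<open>1 / 2 ^ k\<close> of all strings.\<close>
      have "inj_on ?h (Pow ({..<L} - agr e))" by (rule inj_onI) blast
      moreover have "?h ` Pow ({..<L} - agr e) \<subseteq> ?W" using aL by blast
      ultimately have "card (Pow ({..<L} - agr e)) \<le> card ?W"
        by (intro card_inj_on_le) auto
      moreover have "card (Pow ({..<L} - agr e)) = 2 ^ (L - card (agr e))"
        using aL by (simp add: card_Pow card_Diff_subset finite_subset[OF aL])
      ultimately have le: "2 ^ (L - card (agr e)) \<le> card ?W" by simp
      have "card (Pow {..<L}) \<le> 2 ^ k * 2 ^ (L - card (agr e))"
        using ca by (simp add: card_Pow power_add[symmetric])
      also have "\<dots> \<le> K * card ?W" using K(2) le by (rule mult_le_mono)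
      finally show ?thesis .
    qed
  qed auto
  then obtain c where
    c': "\<forall>i\<in>I. \<exists>e\<in>D i. c e \<in> {d \<in> Pow {..<L}. d \<inter> agr e = \<beta> (fst i) \<inter> agr e}"
    by (elim exE conjE)
  have c: "\<exists>e\<in>D i. c e \<inter> agr e = \<beta> (fst i) \<inter> agr e" if "i \<in> I" for i
    using bspec[OF c' that] unfolding mem_Collect_eq by blast
  \<comment> \<open>The first projection of an edge is a singleton exactly when the edge lies in a row.\<close>
  define \<chi> where "\<chi> e =
    (if if card (fst ` e) = 1 then \<phi> (snd ` e) = p (the_elem (fst ` e)) (sep (snd ` e))
        else c (fst ` e) \<inter> agr (fst ` e) = \<beta> (the_elem (snd ` e)) \<inter> agr (fst ` e)
     then Red else Blue)" for e :: "(nat \<times> nat) set"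
  have row: "\<chi> {(x, y), (x, y')} = Red \<longleftrightarrow> \<phi> {y, y'} = p x (sep {y, y'})" for x y y'
    by (simp add: \<chi>_def)
  have col: "\<chi> {(x, y), (x', y)} = Red \<longleftrightarrow> c {x, x'} \<inter> agr {x, x'} = \<beta> y \<inter> agr {x, x'}"
    if "x \<noteq> x'" for x x' y
    using that by (simp add: \<chi>_def)
  have row_edge: "{(x, y), (x, y')} \<in> grid_edges N N"
    if "x \<in> {1..N}" "y \<in> {1..N}" "y' \<in> {1..N}" "y \<noteq> y'" for x y y'
    using that unfolding grid_edges_def grid_verts_def grid_adj_def by fastforce
  have col_edge: "{(x, y), (x', y)} \<in> grid_edges N N"
    if "x \<in> {1..N}" "x' \<in> {1..N}" "y \<in> {1..N}" "x \<noteq> x'" for x x' y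
    using that unfolding grid_edges_def grid_verts_def grid_adj_def by fastforce
  have "\<not> (is_rectangle N N S \<and> monochromatic N N \<chi> Red S)" for S
  proof (rule notI, elim conjE)
    assume "is_rectangle N N S" and mono: "monochromatic N N \<chi> Red S"
    then obtain X Y where XY: "X \<subseteq> {1..N}" "Y \<subseteq> {1..N}" "S = X \<times> Y" "card X = 2" "card Y = 2"
      unfolding is_subgrid_def by blast
    then obtain x x' y y' where X: "X = {x, x'}" "x \<noteq> x'" and Y: "Y = {y, y'}" "y \<noteq> y'"
      by (auto simp: card_2_iff)
    have red: "\<chi> e = Red" if "e \<in> grid_edges N N" "e \<subseteq> S" for e
      using mono that by (simp add: monochromatic_def)
    have "\<phi> {y, y'} = p x (sep {y, y'})" "\<phi> {y, y'} = p x' (sep {y, y'})"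
      using red[OF row_edge[of x y y']] red[OF row_edge[of x' y y']] XY X Y by (auto simp: row)
    moreover have s: "sep {y, y'} < L" "(sep {y, y'} \<in> \<beta> y) \<noteq> (sep {y, y'} \<in> \<beta> y')"
      using sep[of "{y, y'}"] XY X Y by (auto simp: E_def)
    \<comment> \<open>Both rows carry the letter \<open>\<phi> {y, y'}\<close> at the separating
      position, so they agree there.\<close>
    ultimately have "sep {y, y'} \<in> agr {x, x'}" by (auto simp: agr_def)
    moreover have "c {x, x'} \<inter> agr {x, x'} = \<beta> y \<inter> agr {x, x'}"
      "c {x, x'} \<inter> agr {x, x'} = \<beta> y' \<inter> agr {x, x'}"
      using red[OF col_edge[of x x' y]] red[OF col_edge[of x x' y']] XY X Y by (auto simp: col)
    ultimately show False using s(2) by blast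
  qed
  moreover have "\<not> (is_clique N N n S \<and> monochromatic N N \<chi> Blue S)" for S
  proof (rule notI, elim conjE)
    assume S: "is_clique N N n S" and mono: "monochromatic N N \<chi> Blue S"
    have blue: "\<chi> e \<noteq> Red" if "e \<in> grid_edges N N" "e \<subseteq> S" for e
      using mono that by (simp add: monochromatic_def)
    from clique_line[OF S n] show False
    proof (elim disjE bexE exE conjE)
      fix x T assume x: "x \<in> {1..N}" "T \<subseteq> {1..N}" "card T = n" "S = {x} \<times> T"
      then have i: "(x, T) \<in> I" by (simp add: I_def)
      from \<phi>[OF this] obtain e where e: "e \<in> D (x, T)" "\<phi> e = p x (sep e)" by auto
      obtain y y' where y: "y \<in> {1..N}" "y' \<in> {1..N}" "y \<noteq> y'" "e = {y, y'}"
        using pair DE[OF i] e(1) by blast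
      have "{(x, y), (x, y')} \<subseteq> S" using e(1) x(4) y(4) by (auto simp: D_def)
      with blue[OF row_edge[OF x(1) y(1-3)]] e(2) show False by (simp add: row y(4))
    next
      fix y T assume y: "y \<in> {1..N}" "T \<subseteq> {1..N}" "card T = n" "S = T \<times> {y}"
      then have i: "(y, T) \<in> I" by (simp add: I_def)
      from c[OF this] obtain e where e: "e \<in> D (y, T)" "c e \<inter> agr e = \<beta> y \<inter> agr e" by auto
      obtain x x' where x: "x \<in> {1..N}" "x' \<in> {1..N}" "x \<noteq> x'" "e = {x, x'}"
        using pair DE[OF i] e(1) by blast
      have "{(x, y), (x', y)} \<subseteq> S" using e(1) y(4) x(4) by (auto simp: D_def)
      with blue[OF col_edge[OF x(1,2) y(1) x(3)]] e(2) show False by (simp add: col x)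
    qed
  qed
  ultimately show ?thesis unfolding grid_arrows_def by blast
qed

subsection \<open>The two bounds\<close>

text \<open>Words of length \<open>s\<^sup>2\<close> over \<open>2 ^ s\<close> letters with at most
  \<open>2 * s\<close> agreements are used. After estimating by exponentials, the union bound
  reduces to \<open>K * s\<^sup>2 * (n + 1) < n choose 2\<close>, which holds because
  \<open>K * s\<^sup>2\<close> is at most \<open>2 * q\<close> while \<open>n\<close> is at least
  \<open>q * q\<close>.\<close>

lemma not_grid_arrows_log_square:
  assumes s: "3 \<le> s" and n: "2 ^ (8 * s) \<le> n" and N: "N \<le> 2 ^ s\<^sup>2"
  shows "\<not> grid_arrows N n"
proof -
  define K :: nat where "K = 2 ^ (2 * s + 1)"
  define q :: nat where "q = 2 ^ (4 * s)"
  have "N * 2 ^ s\<^sup>2 \<le> 2 ^ s\<^sup>2 * 2 ^ s\<^sup>2" using N by simp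
  also have "\<dots> = 2 ^ (2 * s\<^sup>2)" by (simp add: power_add[symmetric] mult_2)
  also have "\<dots> < 2 ^ (s * (2 * s + 1))"
    using s by (intro power_strict_increasing) (simp_all add: power2_eq_square algebra_simps)
  also have "\<dots> = (2 ^ s) ^ (2 * s + 1)" by (rule power_mult)
  finally have "N * 2 ^ s\<^sup>2 < (2 ^ s) ^ (2 * s + 1)" .
  \<comment> \<open>The code lemma needs the forbidden number of agreements to be at most the word
    length; this fails for \<open>s = 2\<close>.\<close>
  moreover have "2 * s + 1 \<le> s\<^sup>2"
    using mult_le_mono1[OF s, of s] s unfolding power2_eq_square by linarith
  ultimately obtain p :: "nat \<Rightarrow> nat \<Rightarrow> nat" where
    p: "\<And>x l. x \<in> {1..N} \<Longrightarrow> l < s\<^sup>2 \<Longrightarrow> p x l < 2 ^ s"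
      "\<And>x x'. x \<in> {1..N} \<Longrightarrow> x' \<in> {1..N} \<Longrightarrow> x \<noteq> x' \<Longrightarrow>
        card {l. l < s\<^sup>2 \<and> p x l = p x' l} < 2 * s + 1"
    using code_exists[of N "s\<^sup>2" "2 ^ s" "2 * s + 1"] by blast
  have "s\<^sup>2 \<le> (2 ^ s)\<^sup>2" by (intro power_mono) (simp_all add: less_imp_le)
  also have "\<dots> = 2 ^ (2 * s)" by (simp add: power_mult[symmetric] mult.commute)
  finally have "2 * K * s\<^sup>2 \<le> 2 * K * 2 ^ (2 * s)" by simp
  also have "\<dots> = 4 * q" by (simp add: K_def q_def power_add[symmetric])
  finally have Kq: "2 * K * s\<^sup>2 \<le> 4 * q" .
  have "16 \<le> q"
    unfolding q_def using power_increasing[of 4 "4 * s" "2::nat"] s by simp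
  have "16 * q \<le> q * q" using \<open>16 \<le> q\<close> by simp
  also have "\<dots> = 2 ^ (8 * s)" by (simp add: q_def power_add[symmetric])
  finally have qn: "16 * q \<le> n" using n by simp
  have "2 * (K * s\<^sup>2 * (n + 1)) = 2 * K * s\<^sup>2 * (n + 1)" by simp
  also have "\<dots> \<le> 4 * q * (n + 1)" using Kq by (rule mult_le_mono1)
  also have "\<dots> < 8 * q * n" using qn \<open>16 \<le> q\<close> by simp
  also have "\<dots> \<le> (n - 1) * n" using qn \<open>16 \<le> q\<close> by (intro mult_le_mono1) linarith
  also have "\<dots> = 2 * (n choose 2)"
  proof -
    have "even (n * (n - 1))" by (cases n) auto
    then show ?thesis by (simp only: choose_two dvd_mult_div_cancel mult.commute)
  qed
  finally have less: "K * s\<^sup>2 * (n + 1) < n choose 2" by simp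
  have Kpos: "0 < real K" by (simp add: K_def)
  have "real N ^ (n + 1) \<le> (2 ^ s\<^sup>2) ^ (n + 1)"
    using of_nat_mono[OF N, where ?'a = real] by (intro power_mono) simp_all
  also have "\<dots> = 2 ^ (s\<^sup>2 * (n + 1))" by (rule power_mult[symmetric])
  also have "\<dots> \<le> exp 1 ^ (s\<^sup>2 * (n + 1))"
    using exp_ge_add_one_self[of 1] by (intro power_mono) simp_all
  also have "\<dots> = exp (real (s\<^sup>2 * (n + 1)))" by (simp add: exp_of_nat_mult[symmetric])
  finally have b1: "real N ^ (n + 1) \<le> exp (real (s\<^sup>2 * (n + 1)))" .
  have "1 \<le> real K" unfolding K_def of_nat_power by (rule one_le_power) simp
  then have K1: "0 \<le> 1 - 1 / real K" by simp
  have "(1 - 1 / real K) ^ (n choose 2) \<le> exp (- 1 / real K) ^ (n choose 2)"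
    using exp_ge_add_one_self[of "- 1 / real K"] K1 by (intro power_mono) simp_all
  also have "\<dots> = exp (- (real (n choose 2) / real K))" by (simp add: exp_of_nat_mult[symmetric])
  finally have b2: "(1 - 1 / real K) ^ (n choose 2) \<le> exp (- (real (n choose 2) / real K))" .
  have "real N ^ (n + 1) * (1 - 1 / real K) ^ (n choose 2)
      \<le> exp (real (s\<^sup>2 * (n + 1))) * exp (- (real (n choose 2) / real K))"
    using b1 b2 K1 by (intro mult_mono) simp_all
  also have "\<dots> = exp (real (s\<^sup>2 * (n + 1)) - real (n choose 2) / real K)"
    by (simp add: exp_add[symmetric])
  also have "\<dots> < exp 0"
  proof -
    have "real (K * s\<^sup>2 * (n + 1)) < real (n choose 2)" using less by (rule of_nat_less_iff[THEN iffD2])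
    then have "real (s\<^sup>2 * (n + 1)) * real K < real (n choose 2)"
      by (simp only: of_nat_mult mult_ac)
    then have "real (s\<^sup>2 * (n + 1)) < real (n choose 2) / real K"
      using Kpos by (simp only: pos_less_divide_eq)
    then show ?thesis by (simp only: exp_less_cancel_iff diff_less_0_iff_less)
  qed
  finally have bound: "real N ^ (n + 1) * (1 - 1 / real K) ^ (n choose 2) < 1" by simp
  have "2 ^ s \<le> K" "2 ^ (2 * s) \<le> K"
    unfolding K_def by (intro power_increasing; simp)+
  show ?thesis
  proof (rule not_grid_arrows_of_code[OF N _ _ p(1) _ _ _ bound])
    show "card {l. l < s\<^sup>2 \<and> p x l = p x' l} \<le> 2 * s"
      if "x \<in> {1..N}" "x' \<in> {1..N}" "x \<noteq> x'" for x x'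
      using p(2)[OF that] by simp
  qed (use qn \<open>16 \<le> q\<close> \<open>2 ^ s \<le> K\<close> \<open>2 ^ (2 * s) \<le> K\<close> in simp_all)
qed

text \<open>The all-blue colouring has no red rectangle, and a clique fits into a line of
  \<open>N\<close> points. This covers the small \<open>n\<close> in the lower bound.\<close>

lemma not_grid_arrows_less:
  assumes n: "0 < n" and "N < n"
  shows "\<not> grid_arrows N n"
proof
  assume "grid_arrows N n"
  then consider S where "is_rectangle N N S" "monochromatic N N (\<lambda>_. Blue) Red S"
    | S where "is_clique N N n S"
    unfolding grid_arrows_def by blast
  then show False
  proof cases
    case 1
    then obtain X Y where XY: "X \<subseteq> {1..N}" "Y \<subseteq> {1..N}" "S = X \<times> Y" "card X = 2" "card Y = 2"
      unfolding is_subgrid_def by blast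
    then obtain x y y' where xy: "x \<in> X" "y \<in> Y" "y' \<in> Y" "y \<noteq> y'"
      unfolding card_2_iff by blast
    then have "{(x, y), (x, y')} \<in> grid_edges N N" "{(x, y), (x, y')} \<subseteq> S"
      using XY(1-3) unfolding grid_edges_def grid_verts_def grid_adj_def by fastforce+
    with 1(2) show False unfolding monochromatic_def by blast
  next
    case 2
    from clique_line[OF this n] obtain T where "T \<subseteq> {1..N}" "card T = n" by blast
    then show False using card_mono[of "{1..N}" T] \<open>N < n\<close> by simp
  qed
qed

lemma gr_rect_ge:
  assumes "\<And>N. N < m \<Longrightarrow> \<not> grid_arrows N n"
  shows "enat m \<le> gr_rect n"
  unfolding gr_rect_def
proof (rule Inf_greatest)
  fix x assume "x \<in> {enat N |N. grid_arrows N n}"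
  then obtain N where "x = enat N" "grid_arrows N n" by blast
  with assms[of N] show "enat m \<le> x" by (simp add: not_less[symmetric]) blast
qed

lemma gr_rect_lower:
  assumes n: "2 \<le> n"
  shows "ereal (2 powr (1 / 256 * (log 2 (real n))\<^sup>2)) \<le> ereal_of_enat (gr_rect n)"
proof -
  define l where "l = log 2 (real n)"
  have l1: "1 \<le> l" unfolding l_def using n by (simp add: le_log_iff)
  have nl: "real n = 2 powr l" unfolding l_def using n by simp
  have "\<exists>m. 2 powr (1 / 256 * l\<^sup>2) \<le> real m \<and> (\<forall>N<m. \<not> grid_arrows N n)"
  proof (cases "24 \<le> l")
    case True
    \<comment> \<open>The largest \<open>s\<close> with \<open>2 ^ (8 * s) \<le> n\<close>. Rounding
      down loses at most a factor 2 for \<open>l \<ge> 24\<close>, so \<open>s \<ge> l / 16\<close>,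
      whence the constant \<open>1 / 256\<close>.\<close>
    define s where "s = nat \<lfloor>l / 8\<rfloor>"
    have s3: "3 \<le> s" using True by (simp add: s_def le_nat_iff le_floor_iff)
    have sl: "real s \<le> l / 8" "l / 8 - 1 < real s" using True by (simp_all add: s_def, linarith+)
    have "l / 16 \<le> real s" using sl(2) True by simp
    then have "(l / 16)\<^sup>2 \<le> (real s)\<^sup>2" using True by (intro power_mono) simp_all
    then have "1 / 256 * l\<^sup>2 \<le> real (s\<^sup>2)" by (simp add: power_divide)
    then have "2 powr (1 / 256 * l\<^sup>2) \<le> 2 powr real (s\<^sup>2)" by simp
    also have "\<dots> = real (2 ^ s\<^sup>2)" by (simp only: powr_realpow) simp
    finally have "2 powr (1 / 256 * l\<^sup>2) \<le> real (2 ^ s\<^sup>2)" .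
    moreover have "2 ^ (8 * s) \<le> n"
    proof -
      have "real (2 ^ (8 * s)) = 2 powr real (8 * s)" by (simp add: powr_realpow[symmetric])
      also have "\<dots> \<le> 2 powr l" using sl(1) by simp
      finally show ?thesis unfolding nl[symmetric] by (simp only: of_nat_le_iff)
    qed
    ultimately show ?thesis using not_grid_arrows_log_square[OF s3] less_imp_le by blast
  next
    case False
    \<comment> \<open>For \<open>l < 24\<close> the claimed bound is at most \<open>n\<close>
      itself.\<close>
    have "1 / 256 * l\<^sup>2 \<le> l" using False l1 by (simp add: power2_eq_square)
    then have "2 powr (1 / 256 * l\<^sup>2) \<le> real n" unfolding nl by simp
    moreover have "\<forall>N<n. \<not> grid_arrows N n" using not_grid_arrows_less n by simp
    ultimately show ?thesis by blast
  qed
  then obtain m where m: "2 powr (1 / 256 * l\<^sup>2) \<le> real m" "\<And>N. N < m \<Longrightarrow> \<not> grid_arrows N n"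
    by blast
  have "ereal (2 powr (1 / 256 * l\<^sup>2)) \<le> ereal_of_enat (enat m)" using m(1) by simp
  also have "\<dots> \<le> ereal_of_enat (gr_rect n)" unfolding ereal_of_enat_le_iff using m(2) by (rule gr_rect_ge)
  finally show ?thesis by (simp only: l_def)
qed

lemma gr_rect_upper:
  assumes n: "2 \<le> n"
  shows "ereal_of_enat (gr_rect n) \<le> ereal (2 powr (24 * real n powr (2/3) * log 2 (real n)))"
proof -
  define z where "z = real n powr (1/3)"
  \<comment> \<open>The choice of order \<open>n ^ (1/3)\<close> balances the two main terms
    \<open>r\<^sup>2\<close> and \<open>n / r\<close> of the exponent.\<close>
  define r where "r = nat \<lceil>z\<rceil>"
  define e where "e = r\<^sup>2 + (2 * (8 * n div r) + 4)"
  have z1: "1 < z" unfolding z_def using n by simp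
  have zz: "z\<^sup>2 = real n powr (2/3)" and zzz: "z * z\<^sup>2 = real n"
    using n by (simp_all add: z_def power2_eq_square powr_add[symmetric])
  have r2: "2 \<le> r" using z1 by (simp add: r_def le_nat_iff le_ceiling_iff)
  have rz: "z \<le> real r" "real r \<le> 2 * z" using z1 by (simp_all add: r_def) linarith
  have "real (r\<^sup>2) \<le> (2 * z)\<^sup>2" using rz by (simp only: of_nat_power power_mono of_nat_0_le_iff)
  then have e1: "real (r\<^sup>2) \<le> 4 * z\<^sup>2" by (simp add: power_mult_distrib)
  have "real (8 * n div r) \<le> real (8 * n) / real r" by (rule of_nat_div_le_of_nat)
  also have "\<dots> \<le> real (8 * n) / z" using rz(1) z1 by (intro divide_left_mono) simp_all
  also have "\<dots> = 8 * z\<^sup>2" using z1 by (simp add: zzz[symmetric])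
  finally have e2: "real (8 * n div r) \<le> 8 * z\<^sup>2" .
  have "1 \<le> z\<^sup>2" using z1 by (simp add: one_le_power)
  \<comment> \<open>The three summands of \<open>e\<close> contribute 4, 16 and 4 times
    \<open>z\<^sup>2\<close>.\<close>
  then have "real e \<le> 24 * z\<^sup>2" using e1 e2 by (simp add: e_def)
  then have e: "real e \<le> 24 * real n powr (2/3)" by (simp only: zz)
  have "gr_rect n \<le> enat (n ^ e)"
    unfolding gr_rect_def using grid_arrows_power[OF r2 n] by (intro Inf_lower) (auto simp: e_def)
  then have "ereal_of_enat (gr_rect n) \<le> ereal_of_enat (enat (n ^ e))" by (simp only: ereal_of_enat_le_iff)
  also have "\<dots> = ereal (real n ^ e)" by simp
  also have "real n ^ e = 2 powr (real e * log 2 (real n))"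
  proof -
    have "2 powr (real e * log 2 (real n)) = (2 powr log 2 (real n)) powr real e"
      by (simp only: powr_powr mult.commute)
    then show ?thesis using n by (simp add: powr_realpow)
  qed
  also have "ereal \<dots> \<le> ereal (2 powr (24 * real n powr (2/3) * log 2 (real n)))"
    using e n by (simp add: mult_right_mono)
  finally show ?thesis .
qed

theorem theorem1p3:
  shows "\<exists>c > 0. \<exists>c' > 0. \<forall>n::nat \<ge> 2.
    ereal (2 powr (c * (log 2 (real n))\<^sup>2)) \<le> ereal_of_enat (gr_rect n) \<and>
    ereal_of_enat (gr_rect n) \<le> ereal (2 powr (c' * real n powr (2/3) * log 2 (real n)))"
  using gr_rect_lower gr_rect_upper
  by (intro exI[of _ "1 / 256"] conjI exI[of _ "24"]) simp_all

end
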